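(* Let $H$ be a finite simple graph with $\Delta(H)\le 2$ and let $V_1,\dots,V_n$ be pairwise disjoint subsets of $V(H)$ with $|V_i|=4$ for every $i$. Then $(V_1,\dots,V_n)$ has two disjoint independent sets of representatives.
   Context: An independent set of representatives (ISR) of $(V_1,\dots,V_n)$ is an independent set $R$ of $H$ containing exactly one vertex from each $V_i$. *)

theory Defs
  imports Main
begin

definition simple_graph :: "'a set \<Rightarrow> ('a \<Rightarrow> 'a \<Rightarrow> bool) \<Rightarrow> bool" where
  "simple_graph V E \<longleftrightarrow> finite V \<and> (\<forall>x y. E x y \<longrightarrow> x \<in> V \<and> y \<in> V)
     \<and> (\<forall>x y. E x y \<longrightarrow> E y x) \<and> (\<forall>x. \<not> E x x)"

definition degree :: "('a \<Rightarrow> 'a \<Rightarrow> bool) \<Rightarrow> 'a \<Rightarrow> nat" where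
  "degree E v = card {u. E v u}"

definition max_degree_le :: "'a set \<Rightarrow> ('a \<Rightarrow> 'a \<Rightarrow> bool) \<Rightarrow> nat \<Rightarrow> bool" where
  "max_degree_le V E d \<longleftrightarrow> (\<forall>v\<in>V. degree E v \<le> d)"

definition independent_set :: "'a set \<Rightarrow> ('a \<Rightarrow> 'a \<Rightarrow> bool) \<Rightarrow> 'a set \<Rightarrow> bool" where
  "independent_set V E R \<longleftrightarrow> R \<subseteq> V \<and> (\<forall>x\<in>R. \<forall>y\<in>R. \<not> E x y)"

definition ISR :: "'a set \<Rightarrow> ('a \<Rightarrow> 'a \<Rightarrow> bool) \<Rightarrow> nat \<Rightarrow> (nat \<Rightarrow> 'a set) \<Rightarrow> 'a set \<Rightarrow> bool" where
  "ISR V E n Vs R \<longleftrightarrow> independent_set V E R \<and> R \<subseteq> (\<Union>i<n. Vs i)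
     \<and> (\<forall>i<n. card (R \<inter> Vs i) = 1)"

end

theory Submission
  imports Defs "HOL-Library.Z2"
begin

text \<open>The mod-2 homology of the independence complex gives a Hall-type theorem: a rainbow independent
set exists as soon as, for every set \<open>J\<close> of colours, the independence complex of the vertices
coloured from \<open>J\<close> has no reduced homology below dimension \<open>card J - 1\<close> (Sperner's lemma). When all degrees
are at most 2, this vanishing holds for \<open>4 * card J\<close> vertices, and even for \<open>3 * card J\<close> vertices
if the only cycles are triangles. Hence there is a first ISR. An exchange argument makes it meet every
component with at least 4 vertices; deleting it then leaves paths and triangles and three
vertices per class, so a second ISR exists among the remaining vertices.\<close>

text \<open>These simplification rules would turn sums of bits into bitwise operations and hide the field structure.\<close>

declare add_bit_eq_xor [simp del] bit_not_zero_iff [simp del]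

section \<open>Cancellation in sums modulo 2\<close>

lemma bit_add_self [simp]: "a + a = (0 :: bit)"
  by (cases a) (simp_all add: add_bit_eq_xor)

lemma bit_add_eq_0_iff: "a + b = 0 \<longleftrightarrow> a = (b :: bit)"
  by (cases a; cases b) (simp_all add: add_bit_eq_xor)

text \<open>A fixed-point-free involution splits \<open>S\<close> into pairs, and each pair
  contributes \<open>F a + F a = 0\<close>. All pairwise cancellations below, in boundaries of
  boundaries and in Sperner's lemma, come from here.\<close>

lemma sum_bit_involution:
  fixes F :: "'b \<Rightarrow> bit"
  assumes "finite S"
    and "\<And>a. a \<in> S \<Longrightarrow> p a \<in> S"
    and "\<And>a. a \<in> S \<Longrightarrow> p (p a) = a"
    and "\<And>a. a \<in> S \<Longrightarrow> p a \<noteq> a"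
    and "\<And>a. a \<in> S \<Longrightarrow> F (p a) = F a"
  shows "sum F S = 0"
  using assms
proof (induction S rule: finite_psubset_induct)
  case (psubset S)
  show ?case
  proof (cases "S = {}")
    case False
    then obtain a where a: "a \<in> S" by blast
    define T where "T = S - {a, p a}"
    have "p b \<in> T" if "b \<in> T" for b
      using that psubset.prems(1)[of b] psubset.prems(2)[of b] psubset.prems(2)[OF a] a
      by (auto simp: T_def)
    moreover have "T \<subset> S" using a by (auto simp: T_def)
    ultimately have "sum F T = 0"
      using psubset.prems by (intro psubset.IH) (auto simp: T_def)
    moreover have "S = insert a (insert (p a) T)"
      using a psubset.prems(1) by (auto simp: T_def)
    moreover have "a \<notin> insert (p a) T" "p a \<notin> T" "finite T"
      using psubset.prems(3)[OF a] psubset.hyps by (auto simp: T_def)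
    ultimately show ?thesis
      using psubset.prems(4)[OF a] by (simp add: add.assoc [symmetric])
  qed simp
qed

section \<open>Chains of the independence complex over the field with two elements\<close>

text \<open>\<open>E\<close> is not confined to \<open>U\<close>, so passing to an induced subgraph
  changes \<open>U\<close> alone.\<close>

locale finite_graph =
  fixes U :: "'a set" and E :: "'a \<Rightarrow> 'a \<Rightarrow> bool"
  assumes finite_U: "finite U"
    and sym: "E x y \<Longrightarrow> E y x"
    and irrefl: "\<not> E x x"
begin

definition indep :: "'a set \<Rightarrow> bool" where
  "indep s \<longleftrightarrow> (\<forall>x\<in>s. \<forall>y\<in>s. \<not> E x y)"

text \<open>The simplicial boundary written coefficientwise: the coefficient of \<open>t\<close>
  collects those of all sets with one vertex more. Signs vanish modulo 2, and since the empty set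
  counts as a simplex, the homology is the reduced one.\<close>

definition bd :: "('a set \<Rightarrow> bit) \<Rightarrow> 'a set \<Rightarrow> bit" where
  "bd c t = (\<Sum>x\<in>U - t. c (insert x t))"

definition chain :: "'a set \<Rightarrow> nat \<Rightarrow> ('a set \<Rightarrow> bit) \<Rightarrow> bool" where
  "chain X k c \<longleftrightarrow> (\<forall>s. c s \<noteq> 0 \<longrightarrow> s \<subseteq> X \<and> indep s \<and> card s = k)"

text \<open>The index \<open>k\<close> counts vertices, so \<open>conn X m\<close> says that the reduced homology of the independence
  complex of \<open>X\<close> vanishes in all dimensions below \<open>m - 1\<close>.\<close>

definition conn :: "'a set \<Rightarrow> nat \<Rightarrow> bool" where
  "conn X m \<longleftrightarrow> (\<forall>k<m. \<forall>z. chain X k z \<longrightarrow> (\<forall>t. bd z t = 0) \<longrightarrow>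
     (\<exists>w. chain X (Suc k) w \<and> bd w = z))"

text \<open>The join with the vertex \<open>v\<close>; only the values of \<open>c\<close> on sets
  avoiding \<open>v\<close> enter.\<close>

definition cone :: "'a \<Rightarrow> ('a set \<Rightarrow> bit) \<Rightarrow> 'a set \<Rightarrow> bit" where
  "cone v c s = (if v \<in> s then c (s - {v}) else 0)"

definition avoiding :: "'a \<Rightarrow> ('a set \<Rightarrow> bit) \<Rightarrow> 'a set \<Rightarrow> bit" where
  "avoiding v c s = (if v \<in> s then 0 else c s)"

text \<open>The simplices through \<open>v\<close>, each replaced by its face opposite
  \<open>v\<close>. For a chain of independent sets these faces lie in the link of \<open>v\<close>,
  the independence complex of the non-neighbours.\<close>

definition link :: "'a \<Rightarrow> ('a set \<Rightarrow> bit) \<Rightarrow> 'a set \<Rightarrow> bit" where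
  "link v c s = (if v \<in> s then 0 else c (insert v s))"

lemma conn_mono: "conn X m \<Longrightarrow> m' \<le> m \<Longrightarrow> conn X m'"
  by (auto simp: conn_def)

lemma conn_0: "conn X 0"
  by (simp add: conn_def)

lemma connE:
  assumes "conn X m" "k < m" "chain X k z" "\<And>t. bd z t = 0"
  obtains w where "chain X (Suc k) w" "bd w = z"
  using assms unfolding conn_def by blast

lemma chain_add: "chain X k c \<Longrightarrow> chain X k d \<Longrightarrow> chain X k (\<lambda>s. c s + d s)"
  unfolding chain_def by (metis add_0)

lemma chain_mono: "chain X k c \<Longrightarrow> X \<subseteq> Y \<Longrightarrow> chain Y k c"
  unfolding chain_def by blast

lemma chain_zero: "chain X k (\<lambda>s. 0)"
  by (simp add: chain_def)

lemma chain_sum: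
  assumes "\<And>j. j \<in> J \<Longrightarrow> chain X k (c j)"
  shows "chain X k (\<lambda>s. \<Sum>j\<in>J. c j s)"
  using assms unfolding chain_def by (metis (no_types, lifting) sum.neutral)

lemma bd_add: "bd (\<lambda>s. c s + d s) t = bd c t + bd d t"
  by (simp add: bd_def sum.distrib)

lemma bd_sum: "bd (\<lambda>s. \<Sum>j\<in>J. c j s) t = (\<Sum>j\<in>J. bd (c j) t)"
  unfolding bd_def by (rule sum.swap)

text \<open>Two vertices \<open>x\<close> and \<open>y\<close> are added to \<open>t\<close> in
  either order with the same result, so the terms cancel under swapping.\<close>

lemma bd_bd: "bd (bd c) t = 0"
proof -
  have "bd (bd c) t = (\<Sum>(x, y)\<in>(SIGMA x:U - t. U - insert x t). c (insert y (insert x t)))"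
    unfolding bd_def using finite_U by (subst sum.Sigma) auto
  also have "\<dots> = 0"
    by (rule sum_bit_involution[where p = prod.swap]) (auto simp: finite_U insert_commute)
  finally show ?thesis .
qed

text \<open>The faces of a cone are its base and the cones over the faces of the base.\<close>

lemma bd_cone:
  assumes "v \<in> U" "\<And>s. v \<in> s \<Longrightarrow> c s = 0"
  shows "bd (cone v c) t = c t + cone v (bd c) t"
proof (cases "v \<in> t")
  case False
  have "bd (cone v c) t = (\<Sum>x\<in>U - t. if x = v then c t else 0)"
    unfolding bd_def cone_def using False by (intro sum.cong) auto
  also have "\<dots> = c t"
    using False assms(1) finite_U by simp
  finally show ?thesis using False by (simp add: cone_def)
next
  case True
  have *: "U - (t - {v}) = insert v (U - t)" using True assms(1) by auto
  have "bd c (t - {v}) = c (insert v (t - {v})) + (\<Sum>x\<in>U - t. c (insert x (t - {v})))"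
    unfolding bd_def * using finite_U True by (subst sum.insert) auto
  also have "c (insert v (t - {v})) = 0" by (simp add: assms(2))
  also have "(\<Sum>x\<in>U - t. c (insert x (t - {v}))) = bd (cone v c) t"
    unfolding bd_def cone_def using True by (intro sum.cong) (auto simp: insert_Diff_if)
  finally show ?thesis using True assms(2) by (simp add: cone_def)
qed

lemma chain_cone:
  assumes "chain (X - insert v {y. E v y}) k c" "v \<in> X" "X \<subseteq> U"
  shows "chain X (Suc k) (cone v c)"
  unfolding chain_def
proof (intro allI impI)
  fix s assume "cone v c s \<noteq> 0"
  then have s: "v \<in> s" "c (s - {v}) \<noteq> 0" by (auto simp: cone_def split: if_splits)
  with assms(1) have *: "s - {v} \<subseteq> X - insert v {y. E v y}" "indep (s - {v})" "card (s - {v}) = k"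
    unfolding chain_def by blast+
  have "finite (s - {v})" using * assms(3) finite_U by (meson Diff_subset finite_subset subset_trans)
  then have "card s = Suc k" using s(1) *(3) by (metis card.remove finite_Diff2 finite.emptyI finite.insertI)
  moreover have "indep s" using * irrefl sym unfolding indep_def by blast
  ultimately show "s \<subseteq> X \<and> indep s \<and> card s = Suc k" using * assms(2) by blast
qed

lemma avoiding_plus_cone_link: "c = (\<lambda>s. avoiding v c s + cone v (link v c) s)"
  by (auto simp: fun_eq_iff avoiding_def cone_def link_def insert_absorb)

lemma chain_avoiding: "chain X k c \<Longrightarrow> chain (X - {v}) k (avoiding v c)"
  by (auto simp: chain_def avoiding_def)

lemma chain_link:
  assumes "chain X k c" "v \<in> X" "X \<subseteq> U"
  shows "chain (X - insert v {y. E v y}) (k - 1) (link v c)"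
  unfolding chain_def
proof (intro allI impI)
  fix s assume "link v c s \<noteq> 0"
  then have "v \<notin> s" and c: "c (insert v s) \<noteq> 0" by (auto simp: link_def split: if_splits)
  moreover have *: "insert v s \<subseteq> X" "indep (insert v s)" "card (insert v s) = k"
    using assms(1) c unfolding chain_def by blast+
  moreover have "finite s" using * assms(3) finite_U by (meson finite_subset insert_subset)
  ultimately show "s \<subseteq> X - insert v {y. E v y} \<and> indep s \<and> card s = k - 1"
    by (auto simp: indep_def)
qed

section \<open>Vanishing of homology by deletion and link of a vertex\<close>

text \<open>Every independent set extends by \<open>v\<close>, so the complex is a cone with apex
  \<open>v\<close> and has no reduced homology in any dimension; hence \<open>m\<close> is
  arbitrary.\<close>

lemma conn_isolated:
  assumes "v \<in> X" "X \<subseteq> U" "\<And>y. y \<in> X \<Longrightarrow> \<not> E v y"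
  shows "conn X m"
  unfolding conn_def
proof (intro allI impI)
  fix k z assume z: "chain X k z" and bdz: "\<forall>t. bd z t = 0"
  define z0 where "z0 = avoiding v z"
  define u where "u = link v z"
  have z_eq: "z = (\<lambda>s. z0 s + cone v u s)"
    unfolding z0_def u_def by (rule avoiding_plus_cone_link)
  have z0: "chain (X - {v}) k z0"
    unfolding z0_def using z by (rule chain_avoiding)
  have u: "chain (X - insert v {y. E v y}) (k - 1) u"
    unfolding u_def using z assms(1,2) by (rule chain_link)
  have X: "X - insert v {y. E v y} = X - {v}" using assms(3) by auto
  have vU: "v \<in> U" using assms by blast
  have *: "bd (cone v c) t = c t + cone v (bd c) t" if "c = z0 \<or> c = u" for c t
    using vU that by (intro bd_cone) (auto simp: z0_def u_def avoiding_def link_def)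
  \<comment> \<open>In the vanishing boundary of \<open>z\<close>, evaluated at sets without
    \<open>v\<close>, the simplices through \<open>v\<close> contribute exactly
    \<open>u\<close>.\<close>
  have "bd z0 t = u t" if "v \<notin> t" for t
  proof -
    have "bd z t = bd z0 t + (u t + cone v (bd u) t)"
      using *[of u t] bd_add[of z0 "cone v u" t] z_eq by simp
    then show ?thesis using bdz that by (simp add: cone_def bit_add_eq_0_iff)
  qed
  then have "cone v (bd z0) t = cone v u t" for t by (simp add: cone_def)
  then have "bd (cone v z0) = z" using *[of z0] z_eq by (simp add: fun_eq_iff)
  moreover have "chain X (Suc k) (cone v z0)"
    using chain_cone[OF _ assms(1,2)] z0 X by simp
  ultimately show "\<exists>w. chain X (Suc k) w \<and> bd w = z" by blast
qed

text \<open>The Mayer--Vietoris argument for adding the cone from \<open>v\<close> over its link.\<close>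

lemma conn_vertex:
  assumes "v \<in> X" "X \<subseteq> U" "conn (X - {v}) m" "conn (X - insert v {y. E v y}) (m - 1)"
  shows "conn X m"
  unfolding conn_def
proof (intro allI impI)
  fix k z assume k: "k < m" and z: "chain X k z" and bdz: "\<forall>t. bd z t = 0"
  define z0 where "z0 = avoiding v z"
  define u where "u = link v z"
  have z_eq: "z = (\<lambda>s. z0 s + cone v u s)"
    unfolding z0_def u_def by (rule avoiding_plus_cone_link)
  have z0: "chain (X - {v}) k z0"
    unfolding z0_def using z by (rule chain_avoiding)
  have u: "chain (X - insert v {y. E v y}) (k - 1) u"
    unfolding u_def using z assms(1,2) by (rule chain_link)
  let ?L = "X - insert v {y. E v y}"
  have vU: "v \<in> U" using assms by blast
  \<comment> \<open>The link of a cycle is a cycle: its boundary at \<open>t\<close> is that of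
    \<open>z\<close> at \<open>insert v t\<close>.\<close>
  have "bd u t = 0" for t
  proof (cases "v \<in> t")
    case False
    have "bd u t = (\<Sum>x\<in>U - insert v t. u (insert x t))"
      unfolding bd_def using finite_U vU False
      by (intro sum.mono_neutral_right) (auto simp: u_def link_def)
    also have "\<dots> = bd z (insert v t)"
      unfolding bd_def using False by (intro sum.cong) (auto simp: u_def link_def insert_commute)
    finally show ?thesis using bdz by simp
  qed (simp add: bd_def u_def link_def)
  \<comment> \<open>The case \<open>k = 0\<close> is separate because \<open>k - 1\<close> truncates
    to 0; here \<open>z\<close> is supported on the empty set, which does not contain
    \<open>v\<close>.\<close>
  moreover have "u = (\<lambda>s. 0)" if "k = 0"
  proof
    fix s
    show "u s = 0"
    proof (rule ccontr)
      assume "u s \<noteq> 0"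
      then have "z (insert v s) \<noteq> 0" by (auto simp: u_def link_def split: if_splits)
      then have "insert v s \<subseteq> X" "card (insert v s) = 0" using z that by (auto simp: chain_def)
      then show False using assms(2) finite_U by (metis card_eq_0_iff finite_subset insert_not_empty subset_trans)
    qed
  qed
  ultimately obtain t where t: "chain ?L k t" "bd t = u"
  proof (cases "k = 0")
    case True
    then show ?thesis
      using that[of "\<lambda>s. 0"] \<open>k = 0 \<Longrightarrow> u = (\<lambda>s. 0)\<close> by (auto simp: chain_zero bd_def fun_eq_iff)
  next
    case False
    then show ?thesis
      using connE[OF assms(4) _ u] \<open>\<And>t. bd u t = 0\<close> that k
      by (metis (no_types, lifting) Suc_diff_1 diff_less_mono gr0I less_one not_less)
  qed
  have t0: "t s = 0" if "v \<in> s" for s using t(1) that by (auto simp: chain_def)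
  have bdt: "bd (cone v t) s = t s + cone v u s" for s
    using bd_cone[of v t s] vU t0 t(2) by simp
  \<comment> \<open>Adding \<open>bd (cone v t)\<close> cancels \<open>cone v u\<close>, so
    \<open>y\<close> is homologous to \<open>z\<close> but avoids \<open>v\<close> and can be filled
    after deleting \<open>v\<close>.\<close>
  define y where "y = (\<lambda>s. z0 s + t s)"
  have y: "y s = z s + bd (cone v t) s" for s
    unfolding y_def bdt by (subst z_eq) (simp add: ac_simps)
  have "chain (X - {v}) k y"
    unfolding y_def by (rule chain_add[OF z0 chain_mono[OF t(1)]]) auto
  moreover have "bd y s = 0" for s
  proof -
    have "y = (\<lambda>s. z s + bd (cone v t) s)" using y by blast
    then show ?thesis using bdz bd_bd by (simp add: bd_add)
  qed
  ultimately obtain w where w: "chain (X - {v}) (Suc k) w" "bd w = y"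
    using connE[OF assms(3) k] by blast
  have "chain X (Suc k) (\<lambda>s. w s + cone v t s)"
    by (rule chain_add[OF chain_mono[OF w(1)] chain_cone[OF t(1) assms(1,2)]]) auto
  moreover have "bd (\<lambda>s. w s + cone v t s) = z"
    by (simp add: fun_eq_iff bd_add w(2) y add.assoc)
  ultimately show "\<exists>w. chain X (Suc k) w \<and> bd w = z" by blast
qed

section \<open>The Hall-type theorem for rainbow independent sets\<close>

text \<open>Chains lifting the faces of the simplex on \<open>I\<close> compatibly with the boundary maps.\<close>

lemma ex_simplex_chains:
  assumes "X \<subseteq> U" "finite I"
    and "\<And>J. J \<subseteq> I \<Longrightarrow> conn {x \<in> X. col x \<in> J} (card J)"
  shows "\<exists>c. c {} = (\<lambda>s. if s = {} then 1 else 0) \<and>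
    (\<forall>J \<subseteq> I. chain {x \<in> X. col x \<in> J} (card J) (c J) \<and>
      (J \<noteq> {} \<longrightarrow> bd (c J) = (\<lambda>s. \<Sum>j\<in>J. c (J - {j}) s)))"
proof -
  define good where "good c J \<longleftrightarrow> chain {x \<in> X. col x \<in> J} (card J) (c J) \<and>
      (J \<noteq> {} \<longrightarrow> bd (c J) = (\<lambda>s. \<Sum>j\<in>J. c (J - {j}) s))" for c J
  have "\<exists>c. c {} = (\<lambda>s. if s = {} then 1 else 0) \<and> (\<forall>J \<subseteq> I. card J \<le> n \<longrightarrow> good c J)" for n
  proof (induction n)
    case 0
    have "J = {}" if "J \<subseteq> I" "card J \<le> 0" for J
      using that assms(2) by (metis card_0_eq finite_subset le_zero_eq)
    then show ?case
      by (intro exI[of _ "\<lambda>J s. if s = {} then 1 else 0"]) (auto simp: good_def chain_def indep_def)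
  next
    case (Suc n)
    then obtain c where c0: "c {} = (\<lambda>s. if s = {} then 1 else 0)"
      and c: "\<And>J. J \<subseteq> I \<Longrightarrow> card J \<le> n \<Longrightarrow> good c J" by blast
    \<comment> \<open>The boundary prescribed for \<open>J\<close> is a cycle on sets of
      \<open>n\<close> vertices, so connectivity \<open>Suc n\<close> suffices to fill it.\<close>
    have "\<exists>w. chain {x \<in> X. col x \<in> J} (Suc n) w \<and> bd w = (\<lambda>s. \<Sum>j\<in>J. c (J - {j}) s)"
      if J: "J \<subseteq> I" "card J = Suc n" for J
    proof -
      have fin: "finite J" using J assms(2) finite_subset by blast
      let ?z = "\<lambda>s. \<Sum>j\<in>J. c (J - {j}) s"
      have sub: "good c (J - {j})" "card (J - {j}) = n" if "j \<in> J" for j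
        using c[of "J - {j}"] J that fin by auto
      have "chain {x \<in> X. col x \<in> J} n (c (J - {j}))" if "j \<in> J" for j
      proof (rule chain_mono)
        show "chain {x \<in> X. col x \<in> J - {j}} n (c (J - {j}))"
          using sub[OF that] unfolding good_def by metis
      qed auto
      then have "chain {x \<in> X. col x \<in> J} n ?z" by (rule chain_sum)
      moreover have "bd ?z t = 0" for t
      proof (cases "n = 0")
        case True
        \<comment> \<open>The sum is just \<open>c {}\<close>, supported on the empty simplex, whose
          boundary is 0.\<close>
        then obtain j where "J = {j}" using J by (metis One_nat_def card_1_singletonE)
        then show ?thesis using c0 by (simp add: bd_def)
      next
        case False
        then have ne: "J - {j} \<noteq> {}" if "j \<in> J" for j
          using sub(2)[OF that] by (metis card.empty)
        have "bd ?z t = (\<Sum>j\<in>J. bd (c (J - {j})) t)" by (rule bd_sum)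
        also have "\<dots> = (\<Sum>j\<in>J. \<Sum>i\<in>J - {j}. c (J - {j} - {i}) t)"
          using sub ne by (intro sum.cong) (auto simp: good_def)
        also have "\<dots> = (\<Sum>(j, i)\<in>(SIGMA j:J. J - {j}). c (J - {j} - {i}) t)"
          using fin by (subst sum.Sigma) auto
        \<comment> \<open>Removing \<open>j\<close> and then \<open>i\<close> gives the same face as
          removing \<open>i\<close> and then \<open>j\<close>.\<close>
        also have "\<dots> = 0"
          by (rule sum_bit_involution[where p = prod.swap]) (auto simp: fin Diff_insert2 [symmetric] insert_commute)
        finally show ?thesis .
      qed
      moreover have "conn {x \<in> X. col x \<in> J} (Suc n)" using assms(3)[OF J(1)] J(2) by simp
      ultimately obtain w where "chain {x \<in> X. col x \<in> J} (Suc n) w" "bd w = ?z"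
        using connE[of _ "Suc n" n ?z] by blast
      then show ?thesis by blast
    qed
    then have "\<exists>w. \<forall>J\<in>{J. J \<subseteq> I \<and> card J = Suc n}.
      chain {x \<in> X. col x \<in> J} (Suc n) (w J) \<and> bd (w J) = (\<lambda>s. \<Sum>j\<in>J. c (J - {j}) s)"
      by (intro bchoice) blast
    then obtain w where w: "\<And>J. J \<subseteq> I \<Longrightarrow> card J = Suc n \<Longrightarrow>
      chain {x \<in> X. col x \<in> J} (Suc n) (w J) \<and> bd (w J) = (\<lambda>s. \<Sum>j\<in>J. c (J - {j}) s)"
      by blast
    define c' where "c' J = (if card J = Suc n then w J else c J)" for J
    have "good c' J" if J: "J \<subseteq> I" "card J \<le> Suc n" for J
    proof -
      have fin: "finite J" using J assms(2) finite_subset by blast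
      then have eq: "c' (J - {j}) = c (J - {j})" if "j \<in> J" for j
        using J(2) card_Diff1_less[OF fin that] by (simp add: c'_def)
      have sums: "(\<lambda>s. \<Sum>j\<in>J. c' (J - {j}) s) = (\<lambda>s. \<Sum>j\<in>J. c (J - {j}) s)"
        by (intro ext sum.cong) (auto simp: eq)
      show ?thesis
      proof (cases "card J = Suc n")
        case True
        then show ?thesis using w[OF J(1) True] sums by (simp add: good_def c'_def)
      next
        case False
        then show ?thesis using c[OF J(1)] J(2) sums by (simp add: good_def c'_def)
      qed
    qed
    moreover have "c' {} = (\<lambda>s. if s = {} then 1 else 0)" using c0 by (simp add: c'_def)
    ultimately show ?case by (intro exI[of _ c']) blast
  qed
  from this[of "card I"] obtain c where c: "c {} = (\<lambda>s. if s = {} then 1 else 0)"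
    "\<And>J. J \<subseteq> I \<Longrightarrow> card J \<le> card I \<Longrightarrow> good c J" by blast
  have "good c J" if "J \<subseteq> I" for J
    using c(2)[OF that] card_mono[OF assms(2) that] by simp
  with c(1) show ?thesis unfolding good_def by blast
qed

text \<open>Sperner's lemma for the chains above.\<close>

lemma sum_rainbow_simplices:
  fixes I :: "'i set" and c :: "'i set \<Rightarrow> 'a set \<Rightarrow> bit"
  assumes "X \<subseteq> U" "finite I"
    and c0: "c {} = (\<lambda>s. if s = {} then 1 else 0)"
    and chain: "\<And>J. J \<subseteq> I \<Longrightarrow> chain {x \<in> X. col x \<in> J} (card J) (c J)"
    and bd: "\<And>J. J \<subseteq> I \<Longrightarrow> J \<noteq> {} \<Longrightarrow> bd (c J) = (\<lambda>s. \<Sum>j\<in>J. c (J - {j}) s)"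
    and "J \<subseteq> I"
  shows "(\<Sum>s | s \<subseteq> X \<and> inj_on col s \<and> col ` s = J. c J s) = 1"
proof -
  have "finite J" using assms(2,6) finite_subset by blast
  then show ?thesis using \<open>J \<subseteq> I\<close>
  proof (induction J rule: finite_induct)
    case empty
    have "{s. s \<subseteq> X \<and> inj_on col s \<and> col ` s = {}} = {{}}" by auto
    then show ?case by (simp add: c0)
  next
    case (insert j J)
    define T where "T J = {s. s \<subseteq> X \<and> inj_on col s \<and> col ` s = J}" for J
    have fin: "finite (T J)" for J
    proof (rule finite_subset)
      show "T J \<subseteq> Pow U" using assms(1) by (auto simp: T_def)
    qed (simp add: finite_U)
    have zero: "c K s = 0" if "K \<subseteq> I" "x \<in> s" "col x \<notin> K" for K s x
      using chain[OF that(1)] that(2,3) by (auto simp: chain_def)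
    let ?J = "insert j J"
    \<comment> \<open>The total boundary coefficient over rainbow sets with colours \<open>J\<close>
      is computed twice: first by the prescribed boundary, where only the face omitting
      \<open>j\<close> contributes, then by listing the added vertices.\<close>
    have "(\<Sum>t\<in>T J. bd (c ?J) t) = (\<Sum>t\<in>T J. \<Sum>i\<in>?J. c (?J - {i}) t)"
      using bd[OF insert.prems] by simp
    also have "\<dots> = (\<Sum>t\<in>T J. c J t)"
    proof (intro sum.cong refl)
      fix t assume t: "t \<in> T J"
      have "c (?J - {i}) t = 0" if "i \<in> J" for i
      proof -
        have "i \<in> col ` t" using t that by (simp add: T_def)
        then obtain x where "x \<in> t" "col x = i" by blast
        then show ?thesis using insert.prems by (intro zero[of _ x]) auto
      qed
      then show "(\<Sum>i\<in>?J. c (?J - {i}) t) = c J t"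
        using insert.hyps by simp
    qed
    also have "\<dots> = 1" using insert.IH insert.prems by (simp add: T_def)
    finally have one: "(\<Sum>t\<in>T J. bd (c ?J) t) = 1" .
    define P where "P = (SIGMA t:T J. U - t)"
    \<comment> \<open>Pairs in \<open>A\<close> add the new colour \<open>j\<close>; pairs in
      \<open>B\<close> repeat a colour of \<open>J\<close>. The remaining pairs leave the support of
      \<open>c ?J\<close>.\<close>
    define A where "A = {(t, x) \<in> P. col x = j \<and> x \<in> X}"
    define B where "B = {(t, x) \<in> P. col x \<in> J \<and> x \<in> X}"
    define F where "F = (\<lambda>(t, x). c ?J (insert x t))"
    have finP: "finite P" unfolding P_def using fin finite_U by auto
    have disj: "A \<inter> B = {}" using insert.hyps by (auto simp: A_def B_def)
    have AB: "A \<subseteq> P" "B \<subseteq> P" by (auto simp: A_def B_def)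
    have "(\<Sum>t\<in>T J. bd (c ?J) t) = sum F P"
      unfolding bd_def P_def F_def using fin finite_U by (subst sum.Sigma) auto
    also have "\<dots> = sum F (A \<union> B)"
    proof (rule sum.mono_neutral_right[OF finP])
      show "\<forall>p\<in>P - (A \<union> B). F p = 0"
      proof
        fix p assume p: "p \<in> P - (A \<union> B)"
        obtain t x where tx: "p = (t, x)" by force
        then have "x \<notin> X \<or> col x \<notin> ?J" using p by (auto simp: A_def B_def)
        then show "F p = 0"
          using chain[OF insert.prems] by (auto simp: F_def tx chain_def)
      qed
    qed (use AB in auto)
    also have "\<dots> = sum F A + sum F B"
      by (rule sum.union_disjoint[OF finite_subset[OF AB(1) finP] finite_subset[OF AB(2) finP] disj])
    also have "sum F B = 0"
    proof -
      \<comment> \<open>In \<open>insert x t\<close> exactly two vertices share a colour,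
        \<open>x\<close> and some \<open>y\<close> in \<open>t\<close>. Omitting either leaves a
        rainbow set, so exchanging their roles pairs off \<open>B\<close>.\<close>
      define q where "q = (\<lambda>(t, x). inv_into t col (col x))"
      define p where "p = (\<lambda>(t, x). (insert x (t - {q (t, x)}), q (t, x)))"
      have q: "q (t, x) = y" if "t \<in> T J" "y \<in> t" "col y = col x" for t x y
        unfolding q_def T_def using that
        by (simp add: T_def flip: that(3))
      have B: "\<exists>y. y \<in> t \<and> col y = col x \<and> x \<noteq> y \<and> t \<in> T J \<and> x \<in> X \<and> x \<notin> t \<and> col x \<in> J \<and> y \<in> X
         \<and> p (t, x) = (insert x (t - {y}), y) \<and> insert x (t - {y}) \<in> T J"
        if "(t, x) \<in> B" for t x
      proof -
        have tx: "t \<in> T J" "x \<in> X" "x \<notin> t" "col x \<in> J" using that by (auto simp: B_def P_def)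
        then have t: "t \<subseteq> X" "inj_on col t" "col ` t = J" by (simp_all add: T_def)
        then obtain y where y: "y \<in> t" "col y = col x" using tx(4) by (metis imageE)
        have "insert x (t - {y}) \<in> T J"
          using tx y t by (simp add: T_def) (auto simp: inj_on_def)
        moreover have "p (t, x) = (insert x (t - {y}), y)" using q[OF tx(1) y] by (simp add: p_def)
        moreover have "y \<in> X" "x \<noteq> y" using y t tx by auto
        ultimately show ?thesis using tx y by (intro exI[of _ y] conjI)
      qed
      show ?thesis
      proof (rule sum_bit_involution[where p = p])
        show "finite B" by (rule finite_subset[OF AB(2) finP])
      next
        fix a assume a: "a \<in> B"
        obtain t x where tx: "a = (t, x)" by force
        obtain y where y: "y \<in> t" "col y = col x" "x \<noteq> y" "t \<in> T J" "x \<in> X" "x \<notin> t" "col x \<in> J" "y \<in> X"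
          "p (t, x) = (insert x (t - {y}), y)" "insert x (t - {y}) \<in> T J"
          using B[OF a[unfolded tx]] by blast
        show "p a \<in> B" using y assms(1) by (auto simp: B_def P_def tx)
        have "q (insert x (t - {y}), y) = x" using y by (intro q) auto
        then show "p (p a) = a" using y by (auto simp: tx p_def)
        show "p a \<noteq> a" using y by (auto simp: tx)
        have "insert y (insert x (t - {y})) = insert x t" using y by auto
        then show "F (p a) = F a" using y by (simp add: tx F_def)
      qed
    qed
    also have "sum F A = (\<Sum>s\<in>T ?J. c ?J s)"
    proof -
      \<comment> \<open>A rainbow set with colours \<open>insert j J\<close> has one vertex of
        colour \<open>j\<close>, hence comes from exactly one pair in \<open>A\<close>.\<close>
      let ?h = "\<lambda>(t, x). insert x t"
      have uniq: "x = x' \<and> t = t'"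
        if "(t, x) \<in> A" "(t', x') \<in> A" "insert x t = insert x' t'" for t x t' x'
      proof -
        have "x \<notin> t" "x' \<notin> t'" "col x = j" "col x' = j" "j \<notin> col ` t"
          using that(1,2) insert.hyps by (auto simp: A_def P_def T_def)
        moreover have "x' \<in> insert x t" using that(3) by simp
        ultimately have "x = x'" by (metis image_eqI insertE)
        then show ?thesis using that(3) \<open>x \<notin> t\<close> \<open>x' \<notin> t'\<close> by (simp add: insert_ident)
      qed
      have "bij_betw ?h A (T ?J)"
      proof (rule bij_betw_imageI)
        show "inj_on ?h A"
        proof (rule inj_onI)
          fix p p' assume "p \<in> A" "p' \<in> A" "?h p = ?h p'"
          then show "p = p'"
            using uniq[of "fst p" "snd p" "fst p'" "snd p'"] by (simp add: case_prod_beta prod_eq_iff)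
        qed
        show "?h ` A = T ?J"
        proof
          show "?h ` A \<subseteq> T ?J"
          proof
            fix s assume "s \<in> ?h ` A"
            then obtain t x where "s = insert x t" "t \<in> T J" "x \<in> X" "col x = j" by (auto simp: A_def P_def)
            then show "s \<in> T ?J" using insert.hyps by (auto simp: T_def)
          qed
          show "T ?J \<subseteq> ?h ` A"
          proof
            fix s assume s: "s \<in> T ?J"
            then have "j \<in> col ` s" by (simp add: T_def)
            then obtain x where x: "x \<in> s" "col x = j" by blast
            have "col ` (s - {x}) = J"
              using s x insert.hyps by (simp add: T_def inj_on_image_set_diff[of col s])
            then have "(s - {x}, x) \<in> A"
              using s x assms(1) by (auto simp: A_def P_def T_def inj_on_diff)
            then have "?h (s - {x}, x) \<in> ?h ` A" by (rule imageI)
            then show "s \<in> ?h ` A" using x(1) by (simp add: insert_absorb)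
          qed
        qed
      qed
      then show ?thesis
        using sum.reindex_bij_betw[of ?h A "T ?J" "c ?J"] by (simp add: F_def case_prod_beta)
    qed
    finally show ?case using one by (simp add: T_def)
  qed
qed

text \<open>The coefficients of \<open>c I\<close> on rainbow sets sum to 1, so one of them is
  nonzero; the support of a chain consists of independent sets.\<close>

theorem rainbow_independent_set:
  assumes "X \<subseteq> U" "finite I"
    and "\<And>J. J \<subseteq> I \<Longrightarrow> conn {x \<in> X. col x \<in> J} (card J)"
  shows "\<exists>R \<subseteq> X. indep R \<and> inj_on col R \<and> col ` R = I"
proof -
  obtain c where c: "c {} = (\<lambda>s. if s = {} then 1 else 0)"
    "\<And>J. J \<subseteq> I \<Longrightarrow> chain {x \<in> X. col x \<in> J} (card J) (c J)"
    "\<And>J. J \<subseteq> I \<Longrightarrow> J \<noteq> {} \<Longrightarrow> bd (c J) = (\<lambda>s. \<Sum>j\<in>J. c (J - {j}) s)"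
    using ex_simplex_chains[OF assms] by blast
  have "(\<Sum>s | s \<subseteq> X \<and> inj_on col s \<and> col ` s = I. c I s) = 1"
    by (rule sum_rainbow_simplices[OF assms(1,2) c]) auto
  then have "(\<Sum>s | s \<subseteq> X \<and> inj_on col s \<and> col ` s = I. c I s) \<noteq> 0" by simp
  then obtain s where "s \<subseteq> X" "inj_on col s" "col ` s = I" "c I s \<noteq> 0"
    by (auto elim: sum.not_neutral_contains_not_neutral)
  moreover from this have "indep s" using c(2)[of I] by (auto simp: chain_def)
  ultimately show ?thesis by blast
qed

section \<open>Connectivity for degrees at most 2 and for disjoint cliques\<close>

text \<open>Deleting the only neighbour \<open>x\<close> of \<open>u\<close> isolates
  \<open>u\<close> and leaves a cone, so only the link of \<open>x\<close> restricts the
  connectivity.\<close>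

lemma conn_leaf:
  assumes "u \<in> X" "X \<subseteq> U" "{y \<in> X. E u y} = {x}" "conn (X - insert x {y. E x y}) (m - 1)"
  shows "conn X m"
proof (rule conn_vertex)
  show "x \<in> X" using assms(3) by blast
  have "u \<noteq> x" using assms(3) irrefl by blast
  then show "conn (X - {x}) m"
    using assms(1-3) by (intro conn_isolated[of u]) auto
qed (use assms in auto)

text \<open>In a set with all degrees 2, deleting \<open>v\<close> turns \<open>u\<close> into a leaf at \<open>x\<close>; the last assumption
  bounds the number of vertices lost by deleting \<open>v\<close> and then the closed neighbourhood of \<open>x\<close>.\<close>

lemma conn_degree_le_2:
  assumes deg: "\<And>v. v \<in> U \<Longrightarrow> card {y \<in> U. E v y} \<le> 2" and "3 \<le> d"
    and "X \<subseteq> U" "d * m \<le> card X"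
    and "\<And>Y. Y \<subseteq> X \<Longrightarrow> Y \<noteq> {} \<Longrightarrow> (\<forall>v\<in>Y. card {y \<in> Y. E v y} = 2) \<Longrightarrow>
      \<exists>v u x. u \<in> Y \<and> {y \<in> Y. E u y} = {v, x} \<and> v \<noteq> x \<and>
        card (insert v (insert x {y \<in> Y. E x y})) \<le> d"
  shows "conn X m"
  using assms(3-5)
proof (induction m arbitrary: X)
  case 0
  show ?case by (rule conn_0)
next
  case (Suc m)
  have fin: "finite X" using Suc.prems(1) finite_U finite_subset by blast
  have deg_X: "card {y \<in> X. E v y} \<le> 2" if "v \<in> X" for v
  proof -
    have "card {y \<in> X. E v y} \<le> card {y \<in> U. E v y}"
      using Suc.prems(1) finite_U by (intro card_mono) auto
    then show ?thesis using deg[of v] that Suc.prems(1) by auto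
  qed
  \<comment> \<open>Losing at most \<open>d\<close> vertices leaves at least \<open>d * m\<close>,
    the price of lowering \<open>Suc m\<close> to \<open>m\<close>.\<close>
  have step: "conn (X - S) m" if "card (X \<inter> S) \<le> d" for S
  proof (rule Suc.IH)
    have "card (X - S) = card X - card (X \<inter> S)"
      using fin by (simp add: card_Diff_subset_Int)
    then show "d * m \<le> card (X - S)" using that Suc.prems(2) by simp
    show "\<exists>v u x. u \<in> Y \<and> {y \<in> Y. E u y} = {v, x} \<and> v \<noteq> x \<and>
        card (insert v (insert x {y \<in> Y. E x y})) \<le> d"
      if "Y \<subseteq> X - S" "Y \<noteq> {}" "\<forall>v\<in>Y. card {y \<in> Y. E v y} = 2" for Y
      using Suc.prems(3)[of Y] that by blast
  qed (use Suc.prems(1) in auto)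
  have nbhd: "conn (X - insert x {y. E x y}) m" if "x \<in> X" for x
  proof (rule step)
    have "X \<inter> insert x {y. E x y} = insert x {y \<in> X. E x y}" using that by auto
    then show "card (X \<inter> insert x {y. E x y}) \<le> d"
      using deg_X[OF that] \<open>3 \<le> d\<close> fin by (simp add: card_insert_if)
  qed
  have "X \<noteq> {}" using Suc.prems(2) \<open>3 \<le> d\<close> by auto
  show ?case
  proof (cases "\<forall>v\<in>X. card {y \<in> X. E v y} = 2")
    case False
    then obtain u where u: "u \<in> X" "card {y \<in> X. E u y} \<noteq> 2" by blast
    then have "card {y \<in> X. E u y} = 0 \<or> card {y \<in> X. E u y} = 1" using deg_X[OF u(1)] by linarith
    then show ?thesis
    proof
      assume "card {y \<in> X. E u y} = 0"
      then have "{y \<in> X. E u y} = {}" using fin by simp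
      then show ?thesis using u(1) Suc.prems(1) by (intro conn_isolated[of u]) auto
    next
      assume "card {y \<in> X. E u y} = 1"
      then obtain x where x: "{y \<in> X. E u y} = {x}" by (rule card_1_singletonE)
      then have "x \<in> X" by blast
      then show ?thesis using conn_leaf[OF u(1) Suc.prems(1) x] nbhd by simp
    qed
  next
    case True
    then obtain v u x where vux: "u \<in> X" "{y \<in> X. E u y} = {v, x}" "v \<noteq> x"
      "card (insert v (insert x {y \<in> X. E x y})) \<le> d"
      using Suc.prems(3)[OF subset_refl \<open>X \<noteq> {}\<close>] by blast
    then have vx: "v \<in> X" "x \<in> X" by blast+
    have "u \<noteq> v" using vux(2) irrefl by blast
    show ?thesis
    proof (rule conn_vertex[OF vx(1) Suc.prems(1)])
      show "conn (X - insert v {y. E v y}) (Suc m - 1)" using nbhd[OF vx(1)] by simp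
      show "conn (X - {v}) (Suc m)"
      proof (rule conn_leaf)
        show "u \<in> X - {v}" using vux(1) \<open>u \<noteq> v\<close> by simp
        show "X - {v} \<subseteq> U" using Suc.prems(1) by blast
        show "{y \<in> X - {v}. E u y} = {x}" using vux(2,3) by blast
        have "X \<inter> insert v (insert x {y. E x y}) = insert v (insert x {y \<in> X. E x y})"
          using vx by blast
        then have "conn (X - insert v (insert x {y. E x y})) m" using vux(4) by (intro step) simp
        moreover have "X - {v} - insert x {y. E x y} = X - insert v (insert x {y. E x y})" by blast
        ultimately show "conn (X - {v} - insert x {y. E x y}) (Suc m - 1)" by simp
      qed
    qed
  qed
qed

text \<open>The complex is a join of discrete sets, one for each colour, and each raises the
  connectivity by one. In the induction, deleting a vertex that has a neighbour keeps all colours,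
  and its link loses only one.\<close>

lemma conn_disjoint_cliques:
  assumes "X \<subseteq> U" "\<And>x y. x \<in> U \<Longrightarrow> y \<in> U \<Longrightarrow> E x y \<longleftrightarrow> x \<noteq> y \<and> col x = col y"
  shows "conn X (card (col ` X))"
proof -
  have "finite X" using assms(1) finite_U finite_subset by blast
  then show ?thesis using assms(1)
  proof (induction X rule: finite_psubset_induct)
    case (psubset X)
    show ?case
    proof (cases "\<exists>v\<in>X. \<forall>y\<in>X. \<not> E v y")
      case True
      then show ?thesis using psubset.prems conn_isolated by blast
    next
      case False
      show ?thesis
      proof (cases "X = {}")
        case True
        then show ?thesis by (simp add: conn_0)
      next
        case nonempty: False
        then obtain v where v: "v \<in> X" by blast
        with False obtain y where y: "y \<in> X" "E v y" by blast
        have "v \<in> U" "y \<in> U" using v y psubset.prems by blast+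
        then have vy: "y \<noteq> v" "col y = col v" using assms(2)[of v y] y(2) by metis+
        then have "col v \<in> col ` (X - {v})" using y(1) by (metis Diff_iff image_eqI singletonD)
        then have "col ` (X - {v}) = col ` X" using v by blast
        moreover have "conn (X - {v}) (card (col ` (X - {v})))"
          using v psubset.prems by (intro psubset.IH) auto
        moreover have "X - insert v {y. E v y} = {x \<in> X. col x \<noteq> col v}"
          using assms(2)[OF \<open>v \<in> U\<close>] psubset.prems by (auto simp: subset_iff)
        moreover have "conn {x \<in> X. col x \<noteq> col v} (card (col ` {x \<in> X. col x \<noteq> col v}))"
          using v psubset.prems by (intro psubset.IH) auto
        moreover have "col ` {x \<in> X. col x \<noteq> col v} = col ` X - {col v}" by auto
        moreover have "card (col ` X - {col v}) = card (col ` X) - 1" using v by simp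
        ultimately show ?thesis using conn_vertex[OF v psubset.prems] by simp
      qed
    qed
  qed
qed

end

section \<open>Common partial transversals\<close>

lemma card_fibres:
  assumes "finite X" "finite J"
  shows "card {x \<in> X. f x \<in> J} = (\<Sum>j\<in>J. card {x \<in> X. f x = j})"
proof -
  have "{x \<in> X. f x \<in> J} = (\<Union>j\<in>J. {x \<in> X. f x = j})" by auto
  also have "card \<dots> = (\<Sum>j\<in>J. card {x \<in> X. f x = j})"
    using assms by (intro card_UN_disjoint) auto
  finally show ?thesis .
qed

text \<open>View \<open>U\<close> as the edges of a bipartite multigraph between the values of
  \<open>col\<close> and of \<open>comp\<close>. Degrees are at least \<open>k\<close> on
  \<open>Q\<close> and at most \<open>k\<close> at the colours, so Hall's condition yields a
  matching covering \<open>Q\<close>; here the rainbow theorem supplies it.\<close>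

lemma common_partial_transversal:
  fixes U :: "'a set" and col :: "'a \<Rightarrow> 'i" and comp :: "'a \<Rightarrow> 'q" and k :: nat
  assumes "finite U" "finite Q" "k > 0"
    and col: "\<And>x. x \<in> U \<Longrightarrow> card {y \<in> U. col y = col x} \<le> k"
    and comp: "\<And>q. q \<in> Q \<Longrightarrow> k \<le> card {y \<in> U. comp y = q}"
  shows "\<exists>D \<subseteq> U. inj_on col D \<and> inj_on comp D \<and> comp ` D = Q"
proof -
  \<comment> \<open>Joining vertices of equal colour makes independence mean injectivity of
    \<open>col\<close>, while \<open>comp\<close> takes over as the colouring.\<close>
  interpret G: finite_graph U "\<lambda>x y. x \<noteq> y \<and> col x = col y"
    by standard (use \<open>finite U\<close> in auto)
  have "\<exists>R \<subseteq> U. G.indep R \<and> inj_on comp R \<and> comp ` R = Q"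
  proof (rule G.rainbow_independent_set)
    fix J assume J: "J \<subseteq> Q"
    define X where "X = {x \<in> U. comp x \<in> J}"
    have finJ: "finite J" using J \<open>finite Q\<close> finite_subset by blast
    have finX: "finite X" using \<open>finite U\<close> by (simp add: X_def)
    \<comment> \<open>Double counting of \<open>X\<close>: at least \<open>k\<close> elements over
      each member of \<open>J\<close>, at most \<open>k\<close> in each colour.\<close>
    have "k * card J = (\<Sum>j\<in>J. k)" by simp
    also have "\<dots> \<le> card X"
      unfolding X_def card_fibres[OF \<open>finite U\<close> finJ] using comp J by (intro sum_mono) auto
    also have "\<dots> = (\<Sum>i\<in>col ` X. card {x \<in> X. col x = i})"
    proof -
      have "{x \<in> X. col x \<in> col ` X} = X" by blast
      then show ?thesis using card_fibres[OF finX finite_imageI[OF finX], of col col] by simp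
    qed
    also have "\<dots> \<le> (\<Sum>i\<in>col ` X. k)"
    proof (rule sum_mono)
      fix i assume "i \<in> col ` X"
      then obtain x where x: "x \<in> U" "i = col x" by (auto simp: X_def)
      have "card {x \<in> X. col x = i} \<le> card {y \<in> U. col y = col x}"
        using \<open>finite U\<close> x by (intro card_mono) (auto simp: X_def)
      then show "card {x \<in> X. col x = i} \<le> k" using col[OF x(1)] by simp
    qed
    finally have "card J \<le> card (col ` X)" using \<open>k > 0\<close> by simp
    moreover have "G.conn X (card (col ` X))"
      by (rule G.conn_disjoint_cliques) (auto simp: X_def)
    ultimately show "G.conn {x \<in> U. comp x \<in> J} (card J)"
      using G.conn_mono by (simp add: X_def)
  qed (use assms in auto)
  then obtain R where "R \<subseteq> U" "G.indep R" "inj_on comp R" "comp ` R = Q" by blast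
  moreover have "inj_on col R" using \<open>G.indep R\<close> by (auto simp: G.indep_def inj_on_def)
  ultimately show ?thesis by blast
qed

section \<open>Connected components and the exchange argument\<close>

context finite_graph
begin

definition component :: "'a \<Rightarrow> 'a set" where
  "component x = {(a, b). a \<in> U \<and> b \<in> U \<and> E a b}\<^sup>* `` {x}"

lemma component_refl: "x \<in> component x"
  by (simp add: component_def)

lemma component_subset: "x \<in> U \<Longrightarrow> component x \<subseteq> U"
  unfolding component_def by (auto elim: rtranclE)

lemma component_closed:
  assumes "x \<in> Y" "\<And>a b. a \<in> Y \<Longrightarrow> b \<in> U \<Longrightarrow> E a b \<Longrightarrow> b \<in> Y"
  shows "component x \<subseteq> Y"
proof
  fix y assume "y \<in> component x"
  then have "(x, y) \<in> {(a, b). a \<in> U \<and> b \<in> U \<and> E a b}\<^sup>*" by (simp add: component_def)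
  then show "y \<in> Y" by induction (use assms in auto)
qed

lemma component_eq:
  assumes "y \<in> component x"
  shows "component y = component x"
proof -
  have "sym ({(a, b). a \<in> U \<and> b \<in> U \<and> E a b}\<^sup>*)"
    by (intro sym_rtrancl) (auto simp: sym_def dest: sym)
  then show ?thesis
    using assms unfolding component_def sym_def by (auto intro: rtrancl_trans)
qed

lemma component_adjacent: "x \<in> U \<Longrightarrow> y \<in> U \<Longrightarrow> E x y \<Longrightarrow> component y = component x"
  by (rule component_eq) (auto simp: component_def)

lemma fibre_component:
  assumes "x \<in> U"
  shows "{y \<in> U. component y = component x} = component x"
  using component_subset[OF assms] component_eq component_refl by blast

text \<open>Among all rainbow independent sets take one sharing as many vertices as possible with a common
  partial transversal \<open>D\<close> of the colours and the large components. If it missed the component of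
  some \<open>d \<in> D\<close>, then \<open>d\<close> would have no neighbour in it and could be exchanged for the vertex of
  the same colour.\<close>

lemma rainbow_independent_set_hitting_components:
  assumes "finite I" "k > 0"
    and col: "col ` U \<subseteq> I" "\<And>i. i \<in> I \<Longrightarrow> card {x \<in> U. col x = i} \<le> k"
    and "R0 \<subseteq> U" "indep R0" "inj_on col R0" "col ` R0 = I"
  shows "\<exists>R \<subseteq> U. indep R \<and> inj_on col R \<and> col ` R = I \<and>
    (\<forall>x\<in>U. k \<le> card (component x) \<longrightarrow> component x \<inter> R \<noteq> {})"
proof -
  define Q where "Q = {q \<in> component ` U. k \<le> card q}"
  have "\<exists>D \<subseteq> U. inj_on col D \<and> inj_on component D \<and> component ` D = Q"
  proof (rule common_partial_transversal[OF finite_U _ \<open>k > 0\<close>])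
    show "finite Q" by (simp add: Q_def finite_U)
    show "k \<le> card {y \<in> U. component y = q}" if "q \<in> Q" for q
      using that fibre_component by (auto simp: Q_def)
  qed (use col in auto)
  then obtain D where D: "D \<subseteq> U" "inj_on col D" "component ` D = Q" by blast
  define rainbow where "rainbow R \<longleftrightarrow> R \<subseteq> U \<and> indep R \<and> inj_on col R \<and> col ` R = I" for R
  have finD: "finite D" using D(1) finite_U finite_subset by blast
  have "rainbow R0" using assms by (simp add: rainbow_def)
  moreover have "\<forall>R. rainbow R \<longrightarrow> card (R \<inter> D) < Suc (card D)"
    using finD by (simp add: card_mono le_imp_less_Suc)
  ultimately obtain R where R: "rainbow R"
    and max: "\<And>R'. rainbow R' \<Longrightarrow> card (R' \<inter> D) \<le> card (R \<inter> D)"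
    using ex_has_greatest_nat[of rainbow R0 "\<lambda>R. card (R \<inter> D)" "Suc (card D)"] by blast
  have "component x \<inter> R \<noteq> {}" if x: "x \<in> U" "k \<le> card (component x)" for x
  proof
    assume miss: "component x \<inter> R = {}"
    have "component x \<in> Q" using x by (simp add: Q_def)
    then obtain d where d: "d \<in> D" "component d = component x" using D(3) by auto
    have dU: "d \<in> U" using d D by blast
    have dR: "d \<notin> R" using miss component_refl[of d] d by auto
    obtain r where r: "r \<in> R" "col r = col d"
      using R col(1) dU unfolding rainbow_def by (metis image_eqI image_iff subsetD)
    have nbr: "\<not> E d y" if "y \<in> R" for y
    proof
      assume "E d y"
      then have "component y = component d"
        using component_adjacent[OF dU] R that by (auto simp: rainbow_def)
      then show False using miss that d component_refl[of y] by auto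
    qed
    have "rainbow (insert d (R - {r}))"
      unfolding rainbow_def
    proof (intro conjI)
      show "insert d (R - {r}) \<subseteq> U" using R dU by (auto simp: rainbow_def)
      show "indep (insert d (R - {r}))"
        using R nbr sym irrefl unfolding rainbow_def indep_def by blast
      show "inj_on col (insert d (R - {r}))"
        using R r unfolding rainbow_def inj_on_def by (metis Diff_iff insert_iff)
      show "col ` insert d (R - {r}) = I"
        using R r unfolding rainbow_def by (auto simp: image_iff) metis+
    qed
    then have "card (insert d (R - {r}) \<inter> D) \<le> card (R \<inter> D)" by (rule max)
    \<comment> \<open>\<open>D\<close> has at most one vertex of each colour and \<open>d\<close>
      has the colour of \<open>r\<close>, so the exchange strictly enlarges the intersection with
      \<open>D\<close>.\<close>
    moreover have "r \<notin> D" using r d dR D(2) by (auto simp: inj_on_def)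
    then have "insert d (R - {r}) \<inter> D = insert d (R \<inter> D)" using d by blast
    ultimately show False using finD dR by simp
  qed
  then show ?thesis using R unfolding rainbow_def by blast
qed

section \<open>Two disjoint rainbow independent sets\<close>

theorem two_disjoint_rainbow_independent_sets:
  assumes deg: "\<And>v. v \<in> U \<Longrightarrow> card {y \<in> U. E v y} \<le> 2"
    and "finite I" "col ` U \<subseteq> I" and fibre: "\<And>i. i \<in> I \<Longrightarrow> card {x \<in> U. col x = i} = 4"
  shows "\<exists>R R'. R \<subseteq> U \<and> indep R \<and> inj_on col R \<and> col ` R = I \<and>
    R' \<subseteq> U \<and> indep R' \<and> inj_on col R' \<and> col ` R' = I \<and> R \<inter> R' = {}"
proof -
  have "\<exists>R \<subseteq> U. indep R \<and> inj_on col R \<and> col ` R = I"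
  proof (rule rainbow_independent_set[OF subset_refl \<open>finite I\<close>])
    fix J assume J: "J \<subseteq> I"
    then have "finite J" using \<open>finite I\<close> finite_subset by blast
    then have card: "card {x \<in> U. col x \<in> J} = 4 * card J"
      using card_fibres[OF finite_U \<open>finite J\<close>, of col] fibre J
      by (simp add: subset_iff)
    show "conn {x \<in> U. col x \<in> J} (card J)"
    \<comment> \<open>The bound 4 counts \<open>v\<close>, \<open>x\<close> and the two neighbours
      of \<open>x\<close>.\<close>
    proof (rule conn_degree_le_2[OF deg, where d = 4])
      fix Y assume Y: "Y \<subseteq> {x \<in> U. col x \<in> J}" "Y \<noteq> {}" "\<forall>v\<in>Y. card {y \<in> Y. E v y} = 2"
      then obtain u where u: "u \<in> Y" by blast
      with Y(3) obtain v x where vx: "{y \<in> Y. E u y} = {v, x}" "v \<noteq> x" by (metis card_2_iff)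
      then have "x \<in> Y" by blast
      then have "card (insert v (insert x {y \<in> Y. E x y})) \<le> 4"
        using Y(3) card_insert_le_m1[of 4 "insert x {y \<in> Y. E x y}" v]
          card_insert_le_m1[of 3 "{y \<in> Y. E x y}" x] by simp
      then show "\<exists>v u x. u \<in> Y \<and> {y \<in> Y. E u y} = {v, x} \<and> v \<noteq> x \<and>
        card (insert v (insert x {y \<in> Y. E x y})) \<le> 4" using u vx by blast
    qed (use card in auto)
  qed
  then obtain R0 where R0: "R0 \<subseteq> U" "indep R0" "inj_on col R0" "col ` R0 = I" by blast
  have "\<exists>R \<subseteq> U. indep R \<and> inj_on col R \<and> col ` R = I \<and>
    (\<forall>x\<in>U. 4 \<le> card (component x) \<longrightarrow> component x \<inter> R \<noteq> {})"
    by (rule rainbow_independent_set_hitting_components[OF \<open>finite I\<close> _ \<open>col ` U \<subseteq> I\<close> _ R0])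
      (simp_all add: fibre)
  then obtain R where R: "R \<subseteq> U" "indep R" "inj_on col R" "col ` R = I"
    and hit: "\<And>x. x \<in> U \<Longrightarrow> 4 \<le> card (component x) \<Longrightarrow> component x \<inter> R \<noteq> {}"
    by blast
  have "\<exists>R' \<subseteq> U - R. indep R' \<and> inj_on col R' \<and> col ` R' = I"
  proof (rule rainbow_independent_set[OF Diff_subset \<open>finite I\<close>])
    fix J assume J: "J \<subseteq> I"
    then have "finite J" using \<open>finite I\<close> finite_subset by blast
    have "card {x \<in> U - R. col x = i} = 3" if "i \<in> I" for i
    proof -
      have "i \<in> col ` R" using R(4) that by simp
      then obtain r where r: "r \<in> R" "col r = i" by blast
      then have "{x \<in> U - R. col x = i} = {x \<in> U. col x = i} - {r}"
        using R(3) by (auto simp: inj_on_def)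
      then show ?thesis using fibre[OF that] r R(1) by auto
    qed
    then have card: "card {x \<in> U - R. col x \<in> J} = 3 * card J"
      using card_fibres[of "U - R" J col] \<open>finite J\<close> J finite_U by (simp add: subset_iff)
    show "conn {x \<in> U - R. col x \<in> J} (card J)"
    \<comment> \<open>The bound 3 holds because a 2-regular \<open>Y\<close> avoiding
      \<open>R\<close> consists of whole components, each too small to be forced to meet
      \<open>R\<close>.\<close>
    proof (rule conn_degree_le_2[OF deg, where d = 3])
      fix Y assume Y: "Y \<subseteq> {x \<in> U - R. col x \<in> J}" "Y \<noteq> {}" "\<forall>v\<in>Y. card {y \<in> Y. E v y} = 2"
      then obtain u where u: "u \<in> Y" by blast
      with Y(3) obtain v x where vx: "{y \<in> Y. E u y} = {v, x}" "v \<noteq> x" by (metis card_2_iff)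
      have finY: "finite Y" and YU: "Y \<subseteq> U" using Y(1) finite_U by (auto intro: finite_subset)
      \<comment> \<open>Two neighbours inside \<open>Y\<close> already exhaust the degree bound, so
        no edge leaves \<open>Y\<close>.\<close>
      have nbrs: "{y \<in> U. E a y} = {y \<in> Y. E a y}" if "a \<in> Y" for a
        using that YU Y(3) deg[of a] finite_U
        by (intro card_seteq[symmetric]) auto
      have comp: "component u \<subseteq> Y"
        using u nbrs by (intro component_closed) blast+
      then have "component u \<inter> R = {}" using Y(1) by blast
      then have small: "card (component u) \<le> 3" using hit[of u] u YU by force
      have in_comp: "a \<in> component u" if "a \<in> Y" "E b a" "b \<in> component u" for a b
        using component_adjacent[of b a] component_eq[OF that(3)] component_refl[of a] comp that YU by auto
      have vxY: "v \<in> Y" "x \<in> Y" "E u v" "E u x" using vx by blast+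
      then have vxc: "v \<in> component u" "x \<in> component u"
        using in_comp component_refl by blast+
      have "insert v (insert x {y \<in> Y. E x y}) \<subseteq> component u"
        using vxc in_comp by blast
      then have "card (insert v (insert x {y \<in> Y. E x y})) \<le> 3"
        using small comp finY by (meson card_mono finite_subset le_trans)
      then show "\<exists>v u x. u \<in> Y \<and> {y \<in> Y. E u y} = {v, x} \<and> v \<noteq> x \<and>
        card (insert v (insert x {y \<in> Y. E x y})) \<le> 3" using u vx by blast
    qed (use card in auto)
  qed
  then show ?thesis using R by blast
qed

end

section \<open>From vertex classes to colours\<close>

theorem theorem1p7:
  fixes V :: "'a set" and E :: "'a \<Rightarrow> 'a \<Rightarrow> bool" and n :: nat and Vs :: "nat \<Rightarrow> 'a set"
  assumes "simple_graph V E"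
    and "max_degree_le V E 2"
    and "\<forall>i<n. Vs i \<subseteq> V"
    and "\<forall>i<n. \<forall>j<n. i \<noteq> j \<longrightarrow> Vs i \<inter> Vs j = {}"
    and "\<forall>i<n. card (Vs i) = 4"
  shows "\<exists>R1 R2. ISR V E n Vs R1 \<and> ISR V E n Vs R2 \<and> R1 \<inter> R2 = {}"
proof -
  define U where "U = (\<Union>i<n. Vs i)"
  have UV: "U \<subseteq> V" using assms(3) by (auto simp: U_def)
  have V: "finite V" "\<And>x y. E x y \<Longrightarrow> y \<in> V" "\<And>x y. E x y \<Longrightarrow> E y x" "\<And>x. \<not> E x x"
    using assms(1) unfolding simple_graph_def by blast+
  interpret finite_graph U E
    by standard (use V UV finite_subset in blast)+
  \<comment> \<open>Disjointness of the classes makes the index unique on \<open>U\<close>; outside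
    \<open>U\<close> the value is irrelevant.\<close>
  define col where "col x = (THE i. i < n \<and> x \<in> Vs i)" for x
  have col: "col x = i" if "i < n" "x \<in> Vs i" for x i
    unfolding col_def using that assms(4) by (intro the_equality) blast+
  have fibre: "{x \<in> U. col x = i} = Vs i" if "i < n" for i
    using that col by (auto simp: U_def)
  have ISR: "ISR V E n Vs R" if R: "R \<subseteq> U" "indep R" "inj_on col R" "col ` R = {..<n}" for R
    unfolding ISR_def
  proof (intro conjI allI impI)
    show "independent_set V E R"
      using R UV by (auto simp: independent_set_def indep_def)
    show "R \<subseteq> (\<Union>i<n. Vs i)" using R by (simp add: U_def)
    fix i assume i: "i < n"
    then obtain r where r: "r \<in> R" "col r = i" using R(4) by (metis imageE lessThan_iff)
    then have "R \<inter> Vs i = {r}"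
      using R(1,3) fibre[OF i] by (auto simp: inj_on_def)
    then show "card (R \<inter> Vs i) = 1" by simp
  qed
  have deg: "card {y \<in> U. E v y} \<le> 2" if "v \<in> U" for v
  proof -
    \<comment> \<open>Finiteness excludes the convention that infinite sets have cardinality 0, so
      \<open>degree E v\<close> bounds the degree within \<open>U\<close>.\<close>
    have "finite {y. E v y}" using V by (metis finite_subset mem_Collect_eq subsetI)
    then have "card {y \<in> U. E v y} \<le> degree E v" unfolding degree_def by (intro card_mono) auto
    also have "\<dots> \<le> 2" using assms(2) that UV by (auto simp: max_degree_le_def)
    finally show ?thesis .
  qed
  have range: "col ` U \<subseteq> {..<n}" using col by (auto simp: U_def)
  have card: "card {x \<in> U. col x = i} = 4" if "i \<in> {..<n}" for i
    using that fibre assms(5) by simp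
  have "\<exists>R R'. R \<subseteq> U \<and> indep R \<and> inj_on col R \<and> col ` R = {..<n} \<and>
    R' \<subseteq> U \<and> indep R' \<and> inj_on col R' \<and> col ` R' = {..<n} \<and> R \<inter> R' = {}"
    by (rule two_disjoint_rainbow_independent_sets[OF deg finite_lessThan range card])
  then obtain R R' where R: "R \<subseteq> U" "indep R" "inj_on col R" "col ` R = {..<n}"
    and R': "R' \<subseteq> U" "indep R'" "inj_on col R'" "col ` R' = {..<n}" and "R \<inter> R' = {}"
    by (elim exE conjE)
  with ISR[OF R] ISR[OF R'] show ?thesis by (intro exI conjI)
qed

end
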